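(* Let $X$ be a strongly ordered Banach space with cone $K$, and let $T\colon K\to K$ be a continuous, order-preserving, 1-homogeneous map such that $\sigma_+(T)\neq\varnothing$, where $\sigma_+(T)=\{\lambda>0 : T(x)=\lambda x \text{ for some } x\in K\setminus\{0\}\}$. (i) Suppose that for every $x\in\partial K\setminus\{0\}$ and every $\beta>0$ one has $x-\beta T(x)\notin K$. Then $T(\mathring{K})\subset\mathring{K}$, $\sigma_+(T)$ is a singleton, and all eigenvectors of $T$ (in $K$) lie in $\mathring{K}$. (ii) Suppose that for all $x,y\in K$ with $x-y\in\partial K\setminus\{0\}$ and every $\beta>0$ one has $x-y-\beta\,(T(x)-T(y))\notin K$. Then the unique eigenvalue in $\sigma_+(T)$ is simple.
   Context: An ordered Banach space is a real Banach space $X$ together with a cone $K$, i.e. a nontrivial closed subset $K\subset X$ such that $tK\subset K$ for all $t\ge 0$, $K+K\subset K$, and $K\cap(-K)=\{0\}$. It is strongly ordered if the interior $\mathring{K}$ of $K$ is nonempty. $\partial K$ denotes the boundary of $K$ in $X$. Write $x\preceq y$ if $y-x\in K$. A map $T\colon K\to K$ is order-preserving if $x\preceq y$ implies $T(x)\preceq T(y)$ for $x,y\in K$, and 1-homogeneous if $T(tx)=tT(x)$ for all $t\ge 0$ and $x\in K$. An eigenvector of $T$ is a nonzero $x\in K$ with $T(x)=\lambda x$ for some $\lambda\in\mathbb{R}$, and $\lambda$ is the corresponding eigenvalue. An eigenvalue $\lambda\in\sigma_+(T)$ is called simple if the unit eigenvector $x\in K$, $\|x\|=1$, with $T(x)=\lambda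 x$ is unique (equivalently, any two eigenvectors in $K$ for $\lambda$ are positive multiples of each other). *)

theory Defs
  imports "HOL-Analysis.Analysis"
begin

(* "Nontrivial" means different from {0}; K is nonempty because it contains 0 by the last conjunct. *)
definition ordering_cone :: "'a::real_normed_vector set \<Rightarrow> bool" where
  "ordering_cone K \<longleftrightarrow>
     closed K \<and> K \<noteq> {0} \<and> cone K \<and>
     (\<forall>x\<in>K. \<forall>y\<in>K. x + y \<in> K) \<and>
     K \<inter> uminus ` K = {0}"

definition strong_ordering_cone :: "'a::real_normed_vector set \<Rightarrow> bool" where
  "strong_ordering_cone K \<longleftrightarrow> ordering_cone K \<and> interior K \<noteq> {}"

definition cone_le :: "'a::real_normed_vector set \<Rightarrow> 'a \<Rightarrow> 'a \<Rightarrow> bool" where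
  "cone_le K x y \<longleftrightarrow> y - x \<in> K"

definition order_preserving_on :: "'a::real_normed_vector set \<Rightarrow> ('a \<Rightarrow> 'a) \<Rightarrow> bool" where
  "order_preserving_on K T \<longleftrightarrow> monotone_on K (cone_le K) (cone_le K) T"

definition homogeneous1_on :: "'a::real_normed_vector set \<Rightarrow> ('a \<Rightarrow> 'a) \<Rightarrow> bool" where
  "homogeneous1_on K T \<longleftrightarrow> (\<forall>t\<ge>0. \<forall>x\<in>K. T (t *\<^sub>R x) = t *\<^sub>R T x)"

definition cone_eigenvector ::
    "'a::real_normed_vector set \<Rightarrow> ('a \<Rightarrow> 'a) \<Rightarrow> real \<Rightarrow> 'a \<Rightarrow> bool" where
  "cone_eigenvector K T \<mu> x \<longleftrightarrow> x \<in> K \<and> x \<noteq> 0 \<and> T x = \<mu> *\<^sub>R x"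

definition sigma_plus :: "'a::real_normed_vector set \<Rightarrow> ('a \<Rightarrow> 'a) \<Rightarrow> real set" where
  "sigma_plus K T = {\<mu>. \<mu> > 0 \<and> (\<exists>x. cone_eigenvector K T \<mu> x)}"

definition simple_eigenvalue ::
    "'a::real_normed_vector set \<Rightarrow> ('a \<Rightarrow> 'a) \<Rightarrow> real \<Rightarrow> bool" where
  "simple_eigenvalue K T \<mu> \<longleftrightarrow>
     \<mu> \<in> sigma_plus K T \<and> (\<exists>!x. x \<in> K \<and> norm x = 1 \<and> T x = \<mu> *\<^sub>R x)"

end

theory Submission
  imports Defs
begin

text \<open>Eigenvectors lie in the interior because on a ray through the boundary
  \<open>x - \<beta> T x = (1 - \<beta> \<mu>) x\<close> stays in the cone for small \<open>\<beta>\<close>. Two eigenvectors \<open>x\<close>, \<open>y\<close> are compared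
  through the largest \<open>t\<close> with \<open>t y \<preceq> x\<close>: applying \<open>T\<close> to this relation bounds the eigenvalue of \<open>y\<close> by
  that of \<open>x\<close>, and \<open>x - t y\<close> is a boundary point of the cone, which the hypothesis of (ii) forces to
  vanish when the eigenvalues agree. The hypothesis of (ii) with \<open>y = 0\<close> is that of (i).\<close>

lemma interior_diff_scaleR_mem:
  fixes u v :: "'a::real_normed_vector"
  assumes "u \<in> interior K"
  obtains \<epsilon> where "\<epsilon> > 0" "u - \<epsilon> *\<^sub>R v \<in> K"
proof -
  obtain r where r: "r > 0" "ball u r \<subseteq> K"
    using assms mem_interior by blast
  \<comment> \<open>The summand 1 keeps the denominator positive when \<open>v\<close> is zero, and
    halving leaves a positive margin below \<open>r\<close>.\<close>
  define \<epsilon> where "\<epsilon> = r / (norm v + 1) / 2"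
  have "norm v + 1 > 0"
    using norm_ge_zero[of v] by linarith
  then have pos: "\<epsilon> > 0"
    using r by (simp add: \<epsilon>_def)
  have "\<epsilon> * (norm v + 1) = r / 2"
    using \<open>norm v + 1 > 0\<close> unfolding \<epsilon>_def by (simp add: divide_simps)
  then have "\<epsilon> * norm v < r"
    using pos r by (simp add: distrib_left)
  then have "u - \<epsilon> *\<^sub>R v \<in> ball u r"
    using pos by (simp add: dist_norm)
  with pos r that show thesis by blast
qed

text \<open>A positive multiple of the interior is an open set contained in the cone, hence lies in
  the largest such set.\<close>

lemma interior_scaleR_cone:
  fixes K :: "'a::real_normed_vector set"
  assumes "cone K" "x \<in> interior K" "c > 0"
  shows "c *\<^sub>R x \<in> interior K"
proof -
  have "(*\<^sub>R) c ` interior K \<subseteq> interior K"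
  proof (rule interior_maximal)
    show "(*\<^sub>R) c ` interior K \<subseteq> K"
      using assms interior_subset unfolding cone_def by fastforce
    show "open ((*\<^sub>R) c ` interior K)"
      using assms by (intro open_scaling) auto
  qed
  with assms show ?thesis by blast
qed

text \<open>Translating the interior by an element of \<open>K\<close> gives an open subset of
  \<open>K\<close>.\<close>

lemma interior_add_mem:
  fixes K :: "'a::real_normed_vector set"
  assumes add: "\<And>x y. x \<in> K \<Longrightarrow> y \<in> K \<Longrightarrow> x + y \<in> K"
    and "u \<in> interior K" "v \<in> K"
  shows "u + v \<in> interior K"
proof -
  have "(+) v ` interior K \<subseteq> interior K"
  proof (rule interior_maximal)
    show "(+) v ` interior K \<subseteq> K"
      using add assms(3) interior_subset by blast
  qed (simp add: open_translation)
  with assms show ?thesis by (metis add.commute image_subset_iff)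
qed

lemma strong_ordering_coneD:
  assumes "strong_ordering_cone K"
  shows "closed K" "cone K" "\<And>x y. x \<in> K \<Longrightarrow> y \<in> K \<Longrightarrow> x + y \<in> K"
    "0 \<in> K" "\<And>x. x \<in> K \<Longrightarrow> - x \<in> K \<Longrightarrow> x = 0"
proof -
  have K: "closed K" "cone K" "\<forall>x\<in>K. \<forall>y\<in>K. x + y \<in> K" "K \<inter> uminus ` K = {0}"
    using assms by (auto simp: strong_ordering_cone_def ordering_cone_def)
  show "closed K" "cone K" "\<And>x y. x \<in> K \<Longrightarrow> y \<in> K \<Longrightarrow> x + y \<in> K" "0 \<in> K"
    using K by auto
  show "x = 0" if "x \<in> K" "- x \<in> K" for x
  proof -
    have "x \<in> K \<inter> uminus ` K"
      using that by (metis IntI image_eqI minus_minus)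
    then show ?thesis using K by simp
  qed
qed

text \<open>The admissible \<open>s\<close> form a closed set, so the supremum is attained once the
  set is bounded above. Were it unbounded, \<open>(1 / s) x - y\<close> would lie in the cone for
  arbitrarily large \<open>s\<close> and converge to \<open>- y\<close>, contradicting that the cone
  is pointed and closed.\<close>

lemma maximal_cone_multiple:
  fixes K :: "'a::real_normed_vector set"
  assumes K: "strong_ordering_cone K" and x: "x \<in> interior K" and y: "y \<in> K" "y \<noteq> 0"
  obtains t where "t > 0" "x - t *\<^sub>R y \<in> K" "\<And>s. x - s *\<^sub>R y \<in> K \<Longrightarrow> s \<le> t"
proof -
  note D = strong_ordering_coneD[OF K]
  obtain \<epsilon> where \<epsilon>: "\<epsilon> > 0" "x - \<epsilon> *\<^sub>R y \<in> K"
    using interior_diff_scaleR_mem[OF x] by blast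
  define S where "S = {s. x - s *\<^sub>R y \<in> K}"
  have "- y \<notin> K"
    using D(5) y by blast
  \<comment> \<open>Here \<open>- K\<close> is the complement of \<open>K\<close>, not the negated
    cone.\<close>
  then obtain r where r: "r > 0" "ball (- y) r \<subseteq> - K"
    using D(1) by (metis ComplI open_Compl open_contains_ball)
  have bound: "s \<le> norm x / r" if "s \<in> S" for s
  proof (cases "s > 0")
    case True
    \<comment> \<open>The rescaled point is at distance \<open>norm x / s\<close> from
      \<open>- y\<close>; as a member of \<open>K\<close> it must stay outside the ball.\<close>
    have "(1 / s) *\<^sub>R (x - s *\<^sub>R y) \<in> K"
      using D(2) True that by (simp add: S_def cone_def)
    then have "- y + (1 / s) *\<^sub>R x \<notin> ball (- y) r"
      using True r by (auto simp: scaleR_right_diff_distrib)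
    then have "r \<le> norm x / s"
      using True by (simp add: dist_norm)
    then show ?thesis using True r by (simp add: field_simps)
  next
    case False
    then show ?thesis using r
      by (meson divide_nonneg_pos norm_ge_zero not_less order_trans)
  qed
  then have bdd: "bdd_above S"
    by (auto simp: bdd_above_def)
  have "closed ((\<lambda>s. x - s *\<^sub>R y) -` K)"
    using D(1) by (intro closed_vimage continuous_intros)
  then have "closed S"
    by (simp add: S_def vimage_def)
  \<comment> \<open>This member makes \<open>S\<close> nonempty, and its positivity passes on to the
    supremum.\<close>
  have "\<epsilon> \<in> S" using \<epsilon> by (simp add: S_def)
  then have "Sup S \<in> S"
    using closed_contains_Sup[OF _ bdd \<open>closed S\<close>] by blast
  moreover have up: "s \<le> Sup S" if "s \<in> S" for s
    using cSup_upper[OF that bdd] .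
  ultimately show thesis
    using that[of "Sup S"] up[OF \<open>\<epsilon> \<in> S\<close>] \<epsilon>(1) by (auto simp: S_def)
qed

lemma order_preserving_onD:
  assumes "order_preserving_on K T" "x \<in> K" "y \<in> K" "y - x \<in> K"
  shows "T y - T x \<in> K"
  using assms unfolding order_preserving_on_def monotone_on_def cone_le_def by blast

text \<open>Applying \<open>T\<close> to \<open>t y \<preceq> x\<close> and dividing by
  \<open>\<rho>\<close> shows that \<open>t \<mu> / \<rho>\<close> is again an admissible multiple
  of \<open>y\<close> below \<open>x\<close>; maximality of \<open>t\<close> then gives the
  bound.\<close>

lemma eigenvalue_le:
  fixes K :: "'a::real_normed_vector set"
  assumes K: "strong_ordering_cone K" and ord: "order_preserving_on K T"
    and hom: "homogeneous1_on K T"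
    and x: "x \<in> interior K" "T x = \<rho> *\<^sub>R x" "\<rho> > 0"
    and y: "cone_eigenvector K T \<mu> y"
  shows "\<mu> \<le> \<rho>"
proof -
  note D = strong_ordering_coneD[OF K]
  have y': "y \<in> K" "y \<noteq> 0" "T y = \<mu> *\<^sub>R y"
    using y by (auto simp: cone_eigenvector_def)
  obtain t where t: "t > 0" "x - t *\<^sub>R y \<in> K" "\<And>s. x - s *\<^sub>R y \<in> K \<Longrightarrow> s \<le> t"
    using maximal_cone_multiple[OF K x(1) y'(1,2)] by blast
  have "t *\<^sub>R y \<in> K"
    using D(2) y' t by (simp add: cone_def)
  then have "T x - T (t *\<^sub>R y) \<in> K"
    using order_preserving_onD[OF ord] t x interior_subset by blast
  then have "\<rho> *\<^sub>R x - (t * \<mu>) *\<^sub>R y \<in> K"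
    using hom t y' x by (simp add: homogeneous1_on_def)
  then have "(1 / \<rho>) *\<^sub>R (\<rho> *\<^sub>R x - (t * \<mu>) *\<^sub>R y) \<in> K"
    using D(2) x by (simp add: cone_def)
  then have "x - (t * \<mu> / \<rho>) *\<^sub>R y \<in> K"
    using x by (simp add: scaleR_right_diff_distrib)
  then have "t * \<mu> / \<rho> \<le> t" by (rule t)
  then show ?thesis using t x by (simp add: field_simps)
qed

lemma eigenvector_interior:
  fixes K :: "'a::real_normed_vector set"
  assumes K: "strong_ordering_cone K"
    and bd: "\<forall>x \<in> frontier K - {0}. \<forall>\<beta>>0. x - \<beta> *\<^sub>R T x \<notin> K"
    and x: "cone_eigenvector K T \<mu> x"
  shows "x \<in> interior K"
proof (rule ccontr)
  assume "x \<notin> interior K"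
  note D = strong_ordering_coneD[OF K]
  have x': "x \<in> K" "x \<noteq> 0" "T x = \<mu> *\<^sub>R x"
    using x by (auto simp: cone_eigenvector_def)
  with \<open>x \<notin> interior K\<close> have fr: "x \<in> frontier K - {0}"
    using closure_subset by (auto simp: frontier_def)
  \<comment> \<open>The absolute value makes \<open>\<beta>\<close> positive for either sign of
    \<open>\<mu>\<close>, while \<open>\<beta> \<mu> \<le> 1\<close> keeps the factor
    \<open>1 - \<beta> \<mu>\<close> nonnegative.\<close>
  define \<beta> where "\<beta> = 1 / (\<bar>\<mu>\<bar> + 1)"
  have "\<beta> > 0" "\<beta> * \<mu> \<le> 1"
    by (auto simp: \<beta>_def field_simps)
  then have "(1 - \<beta> * \<mu>) *\<^sub>R x \<in> K"
    using D(2) x' by (simp add: cone_def)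
  then have "x - \<beta> *\<^sub>R T x \<in> K"
    using x' by (simp add: scaleR_left_diff_distrib)
  with bd fr \<open>\<beta> > 0\<close> show False by blast
qed

text \<open>The interior eigenvector \<open>e\<close> serves as a lower barrier: \<open>x\<close>
  dominates some \<open>\<epsilon> e\<close>, so \<open>T x\<close> dominates the interior point
  \<open>\<epsilon> \<rho> e\<close>, and adding a cone element to an interior point stays in the
  interior.\<close>

lemma interior_preserved:
  fixes K :: "'a::real_normed_vector set"
  assumes K: "strong_ordering_cone K" and ord: "order_preserving_on K T"
    and hom: "homogeneous1_on K T"
    and e: "e \<in> interior K" "T e = \<rho> *\<^sub>R e" "\<rho> > 0"
    and x: "x \<in> interior K"
  shows "T x \<in> interior K"
proof -
  note D = strong_ordering_coneD[OF K]
  obtain \<epsilon> where \<epsilon>: "\<epsilon> > 0" "x - \<epsilon> *\<^sub>R e \<in> K"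
    using interior_diff_scaleR_mem[OF x] by blast
  have "e \<in> K" "x \<in> K" using e x interior_subset by blast+
  then have "\<epsilon> *\<^sub>R e \<in> K"
    using D(2) \<epsilon> by (simp add: cone_def)
  then have "T x - T (\<epsilon> *\<^sub>R e) \<in> K"
    using order_preserving_onD[OF ord] \<epsilon> \<open>x \<in> K\<close> by blast
  then have "T x - (\<epsilon> * \<rho>) *\<^sub>R e \<in> K"
    using hom \<epsilon> e \<open>e \<in> K\<close> by (simp add: homogeneous1_on_def)
  moreover have "(\<epsilon> * \<rho>) *\<^sub>R e \<in> interior K"
    using interior_scaleR_cone[OF D(2) e(1)] \<epsilon> e by simp
  ultimately have "(\<epsilon> * \<rho>) *\<^sub>R e + (T x - (\<epsilon> * \<rho>) *\<^sub>R e) \<in> interior K"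
    using interior_add_mem[OF D(3)] by blast
  then show ?thesis by simp
qed

lemma interior_unit_eigenvectors_eq:
  fixes K :: "'a::real_normed_vector set"
  assumes K: "strong_ordering_cone K" and hom: "homogeneous1_on K T"
    and bd: "\<forall>x\<in>K. \<forall>y\<in>K. x - y \<in> frontier K - {0} \<longrightarrow>
              (\<forall>\<beta>>0. x - y - \<beta> *\<^sub>R (T x - T y) \<notin> K)"
    and x: "x \<in> interior K" "T x = \<rho> *\<^sub>R x" "norm x = 1"
    and y: "y \<in> K" "T y = \<rho> *\<^sub>R y" "norm y = 1"
    and "\<rho> > 0"
  shows "x = y"
proof -
  note D = strong_ordering_coneD[OF K]
  have "y \<noteq> 0" using y by auto
  then obtain t where t: "t > 0" "x - t *\<^sub>R y \<in> K" "\<And>s. x - s *\<^sub>R y \<in> K \<Longrightarrow> s \<le> t"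
    using maximal_cone_multiple[OF K x(1) y(1)] by blast
  have "x \<in> K" using x interior_subset by blast
  have ty: "t *\<^sub>R y \<in> K" "T (t *\<^sub>R y) = \<rho> *\<^sub>R t *\<^sub>R y"
    using D(2) y t hom by (auto simp: cone_def homogeneous1_on_def mult.commute)
  \<comment> \<open>From an interior point a further small multiple of \<open>y\<close> could be
    subtracted, against the maximality of \<open>t\<close>.\<close>
  have "x - t *\<^sub>R y \<notin> interior K"
  proof
    assume "x - t *\<^sub>R y \<in> interior K"
    then obtain \<epsilon> where \<epsilon>: "\<epsilon> > 0" "x - t *\<^sub>R y - \<epsilon> *\<^sub>R y \<in> K"
      using interior_diff_scaleR_mem by blast
    then have "x - (t + \<epsilon>) *\<^sub>R y \<in> K"
      by (simp add: scaleR_left_distrib diff_diff_eq)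
    then show False using t(3)[of "t + \<epsilon>"] \<epsilon> by simp
  qed
  then have fr: "x - t *\<^sub>R y \<in> frontier K"
    using t(2) closure_subset by (auto simp: frontier_def)
  \<comment> \<open>The choice \<open>\<beta> = 1 / \<rho>\<close> undoes the action of
    \<open>T\<close> on two eigenvectors for \<open>\<rho>\<close>. The result 0 lies in
    \<open>K\<close>, so a nonzero boundary point would violate the hypothesis.\<close>
  have "x - t *\<^sub>R y - (1 / \<rho>) *\<^sub>R (T x - T (t *\<^sub>R y)) = 0"
    using ty x \<open>\<rho> > 0\<close> by (simp add: scaleR_right_diff_distrib)
  then have "x - t *\<^sub>R y - (1 / \<rho>) *\<^sub>R (T x - T (t *\<^sub>R y)) \<in> K"
    using D(4) by simp
  then have "x - t *\<^sub>R y = 0"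
    using bd fr \<open>x \<in> K\<close> ty(1) \<open>\<rho> > 0\<close>
    by (metis DiffI singletonD zero_less_divide_1_iff)
  then have "x = t *\<^sub>R y" by simp
  moreover from this have "t = 1" using x y t by simp
  ultimately show ?thesis by simp
qed

theorem theorem3:
  fixes K :: "'a::banach set" and T :: "'a \<Rightarrow> 'a"
  assumes "strong_ordering_cone K"
    and "T \<in> K \<rightarrow> K"
    and "continuous_on K T"
    and "order_preserving_on K T"
    and "homogeneous1_on K T"
    and "sigma_plus K T \<noteq> {}"
  shows "((\<forall>x \<in> frontier K - {0}. \<forall>\<beta>>0. x - \<beta> *\<^sub>R T x \<notin> K) \<longrightarrow>
           T ` interior K \<subseteq> interior K \<and>
           is_singleton (sigma_plus K T) \<and>
           (\<forall>\<mu> x. cone_eigenvector K T \<mu> x \<longrightarrow> x \<in> interior K)) \<and>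
         ((\<forall>x\<in>K. \<forall>y\<in>K. x - y \<in> frontier K - {0} \<longrightarrow>
              (\<forall>\<beta>>0. x - y - \<beta> *\<^sub>R (T x - T y) \<notin> K)) \<longrightarrow>
           (\<exists>\<mu>. sigma_plus K T = {\<mu>} \<and> simple_eigenvalue K T \<mu>))"
proof -
  note K = assms(1) and ord = assms(4) and hom = assms(5)
  note D = strong_ordering_coneD[OF K]
  obtain \<rho> e where e: "\<rho> > 0" "cone_eigenvector K T \<rho> e"
    using assms(6) by (auto simp: sigma_plus_def)
  then have e': "e \<in> K" "e \<noteq> 0" "T e = \<rho> *\<^sub>R e"
    by (auto simp: cone_eigenvector_def)
  have part1: "T ` interior K \<subseteq> interior K" "sigma_plus K T = {\<rho>}"
    "\<And>\<mu> x. cone_eigenvector K T \<mu> x \<Longrightarrow> x \<in> interior K"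
    if bd: "\<forall>x \<in> frontier K - {0}. \<forall>\<beta>>0. x - \<beta> *\<^sub>R T x \<notin> K"
  proof -
    note int = eigenvector_interior[OF K bd]
    show "\<And>\<mu> x. cone_eigenvector K T \<mu> x \<Longrightarrow> x \<in> interior K"
      by (rule int)
    show "T ` interior K \<subseteq> interior K"
      using interior_preserved[OF K ord hom int[OF e(2)] e'(3) e(1)] by blast
    have "\<mu> = \<rho>" if "\<mu> \<in> sigma_plus K T" for \<mu>
    proof -
      from that obtain x where x: "\<mu> > 0" "cone_eigenvector K T \<mu> x"
        by (auto simp: sigma_plus_def)
      then have "T x = \<mu> *\<^sub>R x" by (simp add: cone_eigenvector_def)
      \<comment> \<open>Both eigenvectors are interior, so each can be the dominating one, which
        yields both inequalities.\<close>
      then show ?thesis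
        using eigenvalue_le[OF K ord hom int[OF x(2)] _ x(1) e(2)]
          eigenvalue_le[OF K ord hom int[OF e(2)] e'(3) e(1) x(2)] by simp
    qed
    then show "sigma_plus K T = {\<rho>}"
      using e by (auto simp: sigma_plus_def)
  qed
  have part2: "sigma_plus K T = {\<rho>} \<and> simple_eigenvalue K T \<rho>"
    if bd: "\<forall>x\<in>K. \<forall>y\<in>K. x - y \<in> frontier K - {0} \<longrightarrow>
              (\<forall>\<beta>>0. x - y - \<beta> *\<^sub>R (T x - T y) \<notin> K)"
  proof -
    \<comment> \<open>This reduces the hypothesis at \<open>y = 0\<close> to the boundary condition
      of the first part.\<close>
    have T0: "T 0 = 0"
    proof -
      have "T (0 *\<^sub>R 0) = 0 *\<^sub>R T 0"
        using hom D(4) unfolding homogeneous1_on_def by blast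
      then show ?thesis by simp
    qed
    have bd1: "\<forall>x \<in> frontier K - {0}. \<forall>\<beta>>0. x - \<beta> *\<^sub>R T x \<notin> K"
    proof (intro ballI allI impI)
      fix x and \<beta> :: real
      assume x: "x \<in> frontier K - {0}" and "\<beta> > 0"
      then have "x \<in> K" using D(1) frontier_subset_closed by blast
      then show "x - \<beta> *\<^sub>R T x \<notin> K"
        using bd[rule_format, of x 0 \<beta>] x D(4) \<open>\<beta> > 0\<close> T0 by simp
    qed
    note p = part1[OF bd1]
    \<comment> \<open>Normalising \<open>e\<close> supplies the existence half of
      simplicity.\<close>
    define u where "u = (1 / norm e) *\<^sub>R e"
    have u: "u \<in> K" "norm u = 1" "T u = \<rho> *\<^sub>R u"
      using e' D(2) hom by (auto simp: u_def cone_def homogeneous1_on_def)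
    have "x = u" if "x \<in> K" "norm x = 1" "T x = \<rho> *\<^sub>R x" for x
    proof -
      have "cone_eigenvector K T \<rho> x"
        using that by (auto simp: cone_eigenvector_def)
      then show ?thesis
        using interior_unit_eigenvectors_eq[OF K hom bd p(3) that(3,2) u(1,3,2) e(1)] by blast
    qed
    with u have "\<exists>!x. x \<in> K \<and> norm x = 1 \<and> T x = \<rho> *\<^sub>R x" by blast
    then show ?thesis using p(2) by (simp add: simple_eigenvalue_def)
  qed
  show ?thesis
    using part1 part2 by (metis is_singletonI)
qed

end
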